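(* Let $S$ be a set, let $M = (m_{s,t})_{s,t\in S}$ be a Coxeter matrix, and let $A_M$ be the associated Artin group. If all the coefficients of $M$ are finite, then $\Gamma_2(A_M)/\Gamma_3(A_M)$ is of $d$-torsion (i.e. $d\cdot x = 0$ for every element $x$ of this abelian group), where $d = \mathrm{lcm}\{d_{x,y} \mid x,y\in\pi_0(\mathcal{G})\}$.
   Context: For a group $G$, $\Gamma_1(G) = G$ and $\Gamma_{i}(G) = [G, \Gamma_{i-1}(G)]$ for $i \geq 2$. A Coxeter matrix on $S$ is a symmetric matrix $(m_{s,t})_{s,t\in S}$ with coefficients in $\mathbb{N}\cup\{\infty\}$, with $m_{s,s}=1$ and $m_{s,t}\geq 2$ if $s\neq t$. The associated Artin group is $$A_M = \Big\langle S\ \Big|\ \underbrace{ststs\cdots}_{m_{s,t}} = \underbrace{tstst\cdots}_{m_{s,t}}\ \ (s,t\in S,\ m_{s,t}\neq\infty)\Big\rangle.$$ $\mathcal{G}$ is the graph with vertex set $S$ and an edge between $s$ and $t$ whenever $m_{s,t}$ is an odd integer; $\pi_0(\mathcal{G})$ is its set of connected components, and $\bar{s}\in\pi_0(\mathcal{G})$ is the component of $s\in S$. For $x,y\in\pi_0(\mathcal{G})$, set $d_{x,x}=1$ and, if $x\neq y$, $d_{x,y} = \gcd\{ m_{s,t}/2 \mid s,t\in S,\ \bar{s}=x,\ \bar{t}=y\}$ (these $m_{s,t}$ are even). The least common multiple of a (possibly infinite) set of integers is the non-negative generator of the intersection of the ideals of $\mathbb{Z}$ they generate (so it is $0$ if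 the set is unbounded). *)

theory Defs
  imports "HOL-Algebra.Generated_Groups" "HOL-Library.Extended_Nat"
begin

section \<open>Lower central series\<close>

definition commutator_subgroup :: "('a, 'b) monoid_scheme \<Rightarrow> 'a set \<Rightarrow> 'a set \<Rightarrow> 'a set" where
  "commutator_subgroup G H K =
     generate G {h \<otimes>\<^bsub>G\<^esub> k \<otimes>\<^bsub>G\<^esub> inv\<^bsub>G\<^esub> h \<otimes>\<^bsub>G\<^esub> inv\<^bsub>G\<^esub> k | h k. h \<in> H \<and> k \<in> K}"

text \<open>The index starts at 1, with \<open>\<Gamma>\<^sub>1(G) = G\<close>; the value at 0 is irrelevant.\<close>

fun lower_central :: "('a, 'b) monoid_scheme \<Rightarrow> nat \<Rightarrow> 'a set" where
  "lower_central G 0 = carrier G"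
| "lower_central G (Suc 0) = carrier G"
| "lower_central G (Suc (Suc n)) = commutator_subgroup G (carrier G) (lower_central G (Suc n))"


section \<open>Group presentations\<close>

text \<open>A word is a list of letters, \<open>(s, True)\<close> standing for the generator \<open>s\<close> and
  \<open>(s, False)\<close> for its formal inverse.  A relation \<open>(p, q)\<close> stands for the equation \<open>p = q\<close>.\<close>

type_synonym 's word = "('s \<times> bool) list"

definition words :: "'s set \<Rightarrow> 's word set" where
  "words S = lists (S \<times> UNIV)"

inductive_set word_cong :: "'s set \<Rightarrow> ('s word \<times> 's word) set \<Rightarrow> ('s word \<times> 's word) set"
  for S R where
  refl: "w \<in> words S \<Longrightarrow> (w, w) \<in> word_cong S R"
| sym: "(v, w) \<in> word_cong S R \<Longrightarrow> (w, v) \<in> word_cong S R"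
| trans: "(u, v) \<in> word_cong S R \<Longrightarrow> (v, w) \<in> word_cong S R \<Longrightarrow> (u, w) \<in> word_cong S R"
| cancel: "u \<in> words S \<Longrightarrow> v \<in> words S \<Longrightarrow> s \<in> S \<Longrightarrow>
    (u @ [(s, b), (s, \<not> b)] @ v, u @ v) \<in> word_cong S R"
| relation: "u \<in> words S \<Longrightarrow> v \<in> words S \<Longrightarrow> p \<in> words S \<Longrightarrow> q \<in> words S \<Longrightarrow>
    (p, q) \<in> R \<Longrightarrow> (u @ p @ v, u @ q @ v) \<in> word_cong S R"

definition presented_group :: "'s set \<Rightarrow> ('s word \<times> 's word) set \<Rightarrow> 's word set monoid" where
  "presented_group S R =
     \<lparr>carrier = words S // word_cong S R,
      mult = (\<lambda>U V. \<Union>x\<in>U. \<Union>y\<in>V. word_cong S R `` {x @ y}),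
      one = word_cong S R `` {[]}\<rparr>"

lemma words_simps [simp]:
  "[] \<in> words S" "(u @ v \<in> words S) = (u \<in> words S \<and> v \<in> words S)"
  "(x # u \<in> words S) = (fst x \<in> S \<and> u \<in> words S)"
  unfolding words_def by (cases x; auto)+

lemma word_cong_words: "(u, v) \<in> word_cong S R \<Longrightarrow> u \<in> words S \<and> v \<in> words S"
  by (induction rule: word_cong.induct) auto

lemma equiv_word_cong: "equiv (words S) (word_cong S R)"
proof (rule equivI)
  show "word_cong S R \<subseteq> words S \<times> words S"
    using word_cong_words by fast
  show "refl_on (words S) (word_cong S R)"
    by (auto simp: refl_on_def intro: word_cong.refl)
  show "sym (word_cong S R)" by (rule symI) (rule word_cong.sym)
  show "trans (word_cong S R)" by (rule transI) (rule word_cong.trans)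
qed

lemma word_cong_context:
  "(u, v) \<in> word_cong S R \<Longrightarrow> a \<in> words S \<Longrightarrow> b \<in> words S \<Longrightarrow>
    (a @ u @ b, a @ v @ b) \<in> word_cong S R"
proof (induction rule: word_cong.induct)
  case (cancel u v s c)
  then show ?case using word_cong.cancel[of "a @ u" S "v @ b" s c R] by simp
next
  case (relation u v p q)
  then show ?case using word_cong.relation[of "a @ u" S "v @ b" p q R] by simp
next
  case (refl w)
  then show ?case by (simp add: word_cong.refl)
next
  case (sym v w)
  then show ?case by (simp add: word_cong.sym)
next
  case (trans u v w)
  then show ?case by (meson word_cong.trans)
qed

lemma word_cong_append:
  assumes "(u, u') \<in> word_cong S R" "(v, v') \<in> word_cong S R"
  shows "(u @ v, u' @ v') \<in> word_cong S R"
proof -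
  have "(u @ v, u' @ v) \<in> word_cong S R"
    using word_cong_context[OF assms(1), of "[]" v] word_cong_words[OF assms(2)] by simp
  moreover have "(u' @ v, u' @ v') \<in> word_cong S R"
    using word_cong_context[OF assms(2), of u' "[]"] word_cong_words[OF assms(1)] by simp
  ultimately show ?thesis by (rule word_cong.trans)
qed

lemma presented_group_mult:
  assumes "u \<in> words S" "v \<in> words S"
  shows "word_cong S R `` {u} \<otimes>\<^bsub>presented_group S R\<^esub> word_cong S R `` {v}
           = word_cong S R `` {u @ v}"
proof -
  let ?C = "\<lambda>w. word_cong S R `` {w}"
  have "?C (x @ y) = ?C (u @ v)" if "x \<in> ?C u" "y \<in> ?C v" for x y
    using equiv_class_eq[OF equiv_word_cong word_cong_append[of u x S R v y]] that by simp
  moreover have "u \<in> ?C u" "v \<in> ?C v"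
    using assms by (simp_all add: word_cong.refl)
  ultimately have "(\<Union>x\<in>?C u. \<Union>y\<in>?C v. ?C (x @ y)) = ?C (u @ v)"
    by (metis (no_types, lifting) UN_constant_eq)
  then show ?thesis by (simp add: presented_group_def)
qed

definition inv_word :: "'s word \<Rightarrow> 's word" where
  "inv_word w = rev (map (\<lambda>(s, b). (s, \<not> b)) w)"

lemma inv_word_words: "w \<in> words S \<Longrightarrow> inv_word w \<in> words S"
  by (induction w) (auto simp: inv_word_def)

lemma inv_word_cancel: "w \<in> words S \<Longrightarrow> (inv_word w @ w, []) \<in> word_cong S R"
proof (induction w)
  case Nil
  then show ?case by (simp add: inv_word_def word_cong.refl)
next
  case (Cons x w)
  obtain s b where x: "x = (s, b)" by (cases x)
  have "inv_word (x # w) @ x # w = inv_word w @ [(s, \<not> b), (s, \<not> \<not> b)] @ w"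
    by (simp add: inv_word_def x)
  moreover have "(inv_word w @ [(s, \<not> b), (s, \<not> \<not> b)] @ w, inv_word w @ w) \<in> word_cong S R"
    using Cons.prems by (intro word_cong.cancel) (auto simp: x inv_word_words)
  ultimately show ?case using Cons by (metis word_cong.trans words_simps(3))
qed

lemma group_presented_group: "group (presented_group S R)"
proof (rule groupI)
  let ?G = "presented_group S R"
  have carr: "carrier ?G = words S // word_cong S R"
    and one: "\<one>\<^bsub>?G\<^esub> = word_cong S R `` {[]}"
    by (simp_all add: presented_group_def)
  show "\<one>\<^bsub>?G\<^esub> \<in> carrier ?G"
    unfolding carr one by (simp add: quotientI)
  fix x assume "x \<in> carrier ?G"
  then obtain u where u: "u \<in> words S" "x = word_cong S R `` {u}"
    unfolding carr by (elim quotientE)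
  show "\<one>\<^bsub>?G\<^esub> \<otimes>\<^bsub>?G\<^esub> x = x"
    using u unfolding one by (simp add: presented_group_mult)
  have "word_cong S R `` {inv_word u} \<otimes>\<^bsub>?G\<^esub> x = \<one>\<^bsub>?G\<^esub>"
    using u equiv_class_eq[OF equiv_word_cong inv_word_cancel[OF u(1)]]
    unfolding one by (simp add: presented_group_mult inv_word_words)
  then show "\<exists>y\<in>carrier ?G. y \<otimes>\<^bsub>?G\<^esub> x = \<one>\<^bsub>?G\<^esub>"
    using inv_word_words[OF u(1)] unfolding carr by (blast intro: quotientI)
  fix y assume "y \<in> carrier ?G"
  then obtain v where v: "v \<in> words S" "y = word_cong S R `` {v}"
    unfolding carr by (elim quotientE)
  show "x \<otimes>\<^bsub>?G\<^esub> y \<in> carrier ?G"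
    using u v unfolding carr by (simp add: presented_group_mult quotientI)
  fix z assume "z \<in> carrier ?G"
  then obtain w where w: "w \<in> words S" "z = word_cong S R `` {w}"
    unfolding carr by (elim quotientE)
  show "x \<otimes>\<^bsub>?G\<^esub> y \<otimes>\<^bsub>?G\<^esub> z = x \<otimes>\<^bsub>?G\<^esub> (y \<otimes>\<^bsub>?G\<^esub> z)"
    using u v w by (simp add: presented_group_mult)
qed


section \<open>Artin groups\<close>

definition coxeter_matrix :: "'s set \<Rightarrow> ('s \<Rightarrow> 's \<Rightarrow> enat) \<Rightarrow> bool" where
  "coxeter_matrix S M \<longleftrightarrow>
     (\<forall>s\<in>S. \<forall>t\<in>S. M s t = M t s) \<and>
     (\<forall>s\<in>S. M s s = 1) \<and>
     (\<forall>s\<in>S. \<forall>t\<in>S. s \<noteq> t \<longrightarrow> M s t \<ge> 2)"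

text \<open>The positive word \<open>s t s t \<dots>\<close> with \<open>n\<close> letters.\<close>

definition alternating_word :: "nat \<Rightarrow> 's \<Rightarrow> 's \<Rightarrow> 's word" where
  "alternating_word n s t = map (\<lambda>i. (if even i then s else t, True)) [0..<n]"

definition artin_relations :: "'s set \<Rightarrow> ('s \<Rightarrow> 's \<Rightarrow> enat) \<Rightarrow> ('s word \<times> 's word) set" where
  "artin_relations S M =
     {(alternating_word m s t, alternating_word m t s) | s t m. s \<in> S \<and> t \<in> S \<and> M s t = enat m}"

definition artin_group :: "'s set \<Rightarrow> ('s \<Rightarrow> 's \<Rightarrow> enat) \<Rightarrow> 's word set monoid" where
  "artin_group S M = presented_group S (artin_relations S M)"


section \<open>The odd graph and the numbers \<open>d\<close>\<close>

definition odd_edges :: "'s set \<Rightarrow> ('s \<Rightarrow> 's \<Rightarrow> enat) \<Rightarrow> ('s \<times> 's) set" where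
  "odd_edges S M = {(s, t). s \<in> S \<and> t \<in> S \<and> (\<exists>m. M s t = enat m \<and> odd m)}"

text \<open>A connected component is represented by its set of vertices: a class of the relation
  ``joined by a path'' on \<open>S\<close>.  In particular \<open>s\<close> has component \<open>x\<close> iff \<open>s \<in> x\<close>.
  (The loops \<open>M s s = 1\<close> do not affect the components.)\<close>

definition odd_components :: "'s set \<Rightarrow> ('s \<Rightarrow> 's \<Rightarrow> enat) \<Rightarrow> 's set set" where
  "odd_components S M = S // Restr ((odd_edges S M)\<^sup>*) S"

text \<open>For distinct components \<open>x\<close>, \<open>y\<close> every finite \<open>M s t\<close> with \<open>s \<in> x\<close>, \<open>t \<in> y\<close> is even, so
  \<open>div\<close> is exact here.  Infinite coefficients contribute nothing to the gcd.\<close>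

definition component_gcd :: "('s \<Rightarrow> 's \<Rightarrow> enat) \<Rightarrow> 's set \<Rightarrow> 's set \<Rightarrow> nat" where
  "component_gcd M x y =
     (if x = y then 1 else Gcd {m div 2 | s t m. s \<in> x \<and> t \<in> y \<and> M s t = enat m})"

text \<open>\<open>Lcm\<close> on \<open>nat\<close> is the non-negative generator of the intersection of the ideals generated
  by the members; it is \<open>0\<close> for infinite, equivalently unbounded, sets and \<open>1\<close> for the empty set.\<close>

definition component_lcm :: "'s set \<Rightarrow> ('s \<Rightarrow> 's \<Rightarrow> enat) \<Rightarrow> nat" where
  "component_lcm S M =
     Lcm {component_gcd M x y | x y. x \<in> odd_components S M \<and> y \<in> odd_components S M}"

end

theory Submission
  imports Defs "HOL-Algebra.Multiplicative_Group"
begin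

text \<open>In the class-two quotient \<open>A / \<Gamma>\<^sub>3(A)\<close> commutators are central, so the commutator is
  bilinear.  An odd relation \<open>(st)\<^sup>k s = (ts)\<^sup>k t\<close> makes \<open>[s, c] = [t, c]\<close> for every \<open>c\<close>, hence the
  commutator of two generators depends only on their components.  An even relation
  \<open>(st)\<^sup>k = (ts)\<^sup>k\<close> together with \<open>st = [s, t] ts\<close> gives \<open>[s, t]\<^sup>k = 1\<close>.  Hence \<open>[s, t]\<close> is killed by
  the gcd attached to its pair of components, and the lcm kills every commutator.\<close>

section \<open>Commutators in groups of nilpotency class two\<close>

definition commutator :: "('a, 'b) monoid_scheme \<Rightarrow> 'a \<Rightarrow> 'a \<Rightarrow> 'a" where
  "commutator G a b = a \<otimes>\<^bsub>G\<^esub> b \<otimes>\<^bsub>G\<^esub> inv\<^bsub>G\<^esub> a \<otimes>\<^bsub>G\<^esub> inv\<^bsub>G\<^esub> b"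

lemma commutator_subgroup_commutator:
  "commutator_subgroup G H K = generate G {commutator G h k | h k. h \<in> H \<and> k \<in> K}"
  by (simp add: commutator_subgroup_def commutator_def)

context group
begin

lemma commutator_closed [simp, intro]:
  "a \<in> carrier G \<Longrightarrow> b \<in> carrier G \<Longrightarrow> commutator G a b \<in> carrier G"
  by (simp add: commutator_def)

lemma mult_eq_commutator_mult:
  assumes "a \<in> carrier G" "b \<in> carrier G"
  shows "a \<otimes> b = commutator G a b \<otimes> (b \<otimes> a)"
proof -
  have "inv a \<otimes> inv b \<otimes> (b \<otimes> a) = \<one>"
    using assms by (metis inv_closed inv_mult_group l_inv m_closed)
  then show ?thesis
    using assms by (simp add: commutator_def m_assoc)
qed

text \<open>By right cancellation an equation ab = z ba determines z. Commutator identities below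
  are checked in this form instead of by expanding inverses.\<close>

lemma commutator_eqI:
  assumes "a \<in> carrier G" "b \<in> carrier G" "z \<in> carrier G" "a \<otimes> b = z \<otimes> (b \<otimes> a)"
  shows "commutator G a b = z"
  using assms mult_eq_commutator_mult[of a b]
  by (metis commutator_closed m_closed right_cancel)

lemma commutator_one_left [simp]: "a \<in> carrier G \<Longrightarrow> commutator G \<one> a = \<one>"
  by (simp add: commutator_def)

lemma commutator_self [simp]: "a \<in> carrier G \<Longrightarrow> commutator G a a = \<one>"
  by (rule commutator_eqI) auto

lemma commutator_swap:
  assumes "a \<in> carrier G" "b \<in> carrier G"
  shows "commutator G a b = inv (commutator G b a)"
proof (rule commutator_eqI)
  show "a \<otimes> b = inv (commutator G b a) \<otimes> (b \<otimes> a)"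
    using assms by (simp add: mult_eq_commutator_mult[of b a] flip: m_assoc)
qed (use assms in auto)

section \<open>Normality of the lower central series\<close>

lemma conj_commutator:
  assumes "g \<in> carrier G" "a \<in> carrier G" "b \<in> carrier G"
  shows "g \<otimes> commutator G a b \<otimes> inv g = commutator G (g \<otimes> a \<otimes> inv g) (g \<otimes> b \<otimes> inv g)"
proof -
  have *: "inv g \<otimes> (g \<otimes> x) = x" if "x \<in> carrier G" for x
    using that assms by (simp flip: m_assoc)
  show ?thesis
    using assms by (simp add: commutator_def m_assoc inv_mult_group *)
qed

text \<open>Conjugating a commutator gives the commutator of the conjugates, which stay in
  \<open>H\<close> and \<open>K\<close>. So the generating set is invariant under
  conjugation.\<close>

lemma normal_commutator_subgroup:
  assumes "H \<lhd> G" "K \<lhd> G"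
  shows "commutator_subgroup G H K \<lhd> G"
  unfolding commutator_subgroup_commutator
proof (rule normal_generateI)
  note sub = normal_imp_subgroup[OF assms(1)] normal_imp_subgroup[OF assms(2)]
  show "{commutator G h k |h k. h \<in> H \<and> k \<in> K} \<subseteq> carrier G"
    using subgroup.mem_carrier[OF sub(1)] subgroup.mem_carrier[OF sub(2)] by auto
  fix x g
  assume "x \<in> {commutator G h k |h k. h \<in> H \<and> k \<in> K}" and g: "g \<in> carrier G"
  then obtain h k where x: "x = commutator G h k" "h \<in> H" "k \<in> K" by auto
  then have "g \<otimes> x \<otimes> inv g = commutator G (g \<otimes> h \<otimes> inv g) (g \<otimes> k \<otimes> inv g)"
    using g subgroup.mem_carrier[OF sub(1)] subgroup.mem_carrier[OF sub(2)]
    by (simp add: conj_commutator)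
  moreover have "g \<otimes> h \<otimes> inv g \<in> H" "g \<otimes> k \<otimes> inv g \<in> K"
    using x g assms by (auto intro: normal.inv_op_closed2)
  ultimately show "g \<otimes> x \<otimes> inv g \<in> {commutator G h k |h k. h \<in> H \<and> k \<in> K}"
    by blast
qed

lemma normal_carrier: "carrier G \<lhd> G"
  by (simp add: normal_inv_iff subgroup_self)

lemma normal_lower_central: "lower_central G n \<lhd> G"
proof (induction n)
  case (Suc n)
  \<comment> \<open>The commutator recursion starts at index 2, so index 1, where the value is the
    whole group, is split off.\<close>
  then show ?case
    by (cases n) (auto intro: normal_carrier normal_commutator_subgroup)
qed (simp add: normal_carrier)

end

section \<open>Commutators under homomorphisms\<close>

lemma (in group_hom) hom_commutator:
  "a \<in> carrier G \<Longrightarrow> b \<in> carrier G \<Longrightarrow> h (commutator G a b) = commutator H (h a) (h b)"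
  by (simp add: commutator_def)

text \<open>This will carry the second lower central term of the Artin group onto that of a
  homomorphic image.\<close>

lemma (in group_hom) hom_commutator_subgroup:
  assumes "K \<subseteq> carrier G" "L \<subseteq> carrier G"
  shows "h ` commutator_subgroup G K L = commutator_subgroup H (h ` K) (h ` L)"
proof -
  let ?C = "{commutator G a b | a b. a \<in> K \<and> b \<in> L}"
  have "?C \<subseteq> carrier G"
    using assms by auto
  moreover have "h ` ?C = {commutator H a b | a b. a \<in> h ` K \<and> b \<in> h ` L}"
    using assms hom_commutator by (fastforce simp: subset_iff image_iff)
  ultimately show ?thesis
    using generate_img[of ?C] by (simp add: commutator_subgroup_commutator)
qed

section \<open>Bilinearity of central commutators\<close>

text \<open>Nilpotency class at most two is expressed by central commutators, the form in which it
  enters the computations below.\<close>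

locale class_two_group = group +
  assumes commutator_central:
    "a \<in> carrier G \<Longrightarrow> b \<in> carrier G \<Longrightarrow> c \<in> carrier G \<Longrightarrow>
      commutator G a b \<otimes> c = c \<otimes> commutator G a b"
begin

lemma commutator_commute:
  assumes "a \<in> carrier G" "b \<in> carrier G" "c \<in> carrier G" "d \<in> carrier G"
  shows "commutator G a b \<otimes> commutator G c d = commutator G c d \<otimes> commutator G a b"
  by (rule commutator_central) (use assms in auto)

text \<open>Moving \<open>c\<close> leftwards past \<open>b\<close> and then past \<open>a\<close>
  releases one commutator each time; centrality lets both be collected in front.\<close>

lemma commutator_mult_left:
  assumes "a \<in> carrier G" "b \<in> carrier G" "c \<in> carrier G"
  shows "commutator G (a \<otimes> b) c = commutator G a c \<otimes> commutator G b c"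
proof (rule commutator_eqI)
  have "a \<otimes> b \<otimes> c = a \<otimes> commutator G b c \<otimes> (c \<otimes> b)"
    using assms by (simp add: m_assoc mult_eq_commutator_mult[of b c])
  also have "\<dots> = commutator G b c \<otimes> (a \<otimes> c) \<otimes> b"
    using assms by (simp add: commutator_central flip: m_assoc)
  also have "\<dots> = commutator G b c \<otimes> commutator G a c \<otimes> (c \<otimes> (a \<otimes> b))"
    using assms by (simp add: m_assoc mult_eq_commutator_mult[of a c])
  also have "\<dots> = commutator G a c \<otimes> commutator G b c \<otimes> (c \<otimes> (a \<otimes> b))"
    using assms by (simp add: commutator_commute)
  finally show "a \<otimes> b \<otimes> c = commutator G a c \<otimes> commutator G b c \<otimes> (c \<otimes> (a \<otimes> b))" .
qed (use assms in auto)

lemma commutator_inv_left: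
  assumes "a \<in> carrier G" "c \<in> carrier G"
  shows "commutator G (inv a) c = inv (commutator G a c)"
proof (rule inv_equality[symmetric])
  show "commutator G (inv a) c \<otimes> commutator G a c = \<one>"
    using assms by (simp flip: commutator_mult_left)
qed (use assms in auto)

lemma commutator_pow_left:
  assumes "a \<in> carrier G" "c \<in> carrier G"
  shows "commutator G (a [^] (n::nat)) c = commutator G a c [^] n"
  using assms by (induction n) (simp_all add: commutator_mult_left)

text \<open>Swapping the arguments inverts the commutator. This takes the place of linearity in the
  second argument.\<close>

lemma commutator_pow_eq_one_swap:
  assumes "a \<in> carrier G" "b \<in> carrier G" "commutator G a b [^] (n::nat) = \<one>"
  shows "commutator G b a [^] n = \<one>"
  using assms by (simp add: commutator_swap[of b a] nat_pow_inv)

text \<open>For fixed \<open>c\<close>, the element [a, c]^n is multiplicative in \<open>a\<close>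
  because commutators commute. Its kernel is a subgroup containing \<open>X\<close>.\<close>

lemma commutator_pow_eq_one_generate:
  assumes X: "X \<subseteq> carrier G" and c: "c \<in> carrier G" and a: "a \<in> generate G X"
    and "\<And>x. x \<in> X \<Longrightarrow> commutator G x c [^] (n::nat) = \<one>"
  shows "commutator G a c [^] n = \<one>"
  using a
proof induction
  case (eng a b)
  then have "a \<in> carrier G" "b \<in> carrier G"
    using X generate_in_carrier by auto
  then show ?case
    using eng c by (simp add: commutator_mult_left pow_mult_distrib commutator_commute)
next
  case (inv a)
  then show ?case
    using assms by (simp add: subset_iff commutator_inv_left nat_pow_inv)
qed (use assms in auto)

text \<open>Torsion spreads from pairs of generators to all commutators, one argument at a time, and
  then to their products because commutators are central.\<close>

lemma commutator_subgroup_torsion: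
  assumes X: "X \<subseteq> carrier G" "generate G X = carrier G"
    and n: "\<And>x y. x \<in> X \<Longrightarrow> y \<in> X \<Longrightarrow> commutator G x y [^] (n::nat) = \<one>"
    and z: "z \<in> commutator_subgroup G (carrier G) (carrier G)"
  shows "z [^] n = \<one>"
proof -
  have *: "commutator G a y [^] n = \<one>" if "a \<in> carrier G" "y \<in> X" for a y
    by (rule commutator_pow_eq_one_generate[OF X(1)]) (use that X n in auto)
  have comm: "commutator G a b [^] n = \<one>" if "a \<in> carrier G" "b \<in> carrier G" for a b
  \<comment> \<open>The swap brings the second argument to the left, where
    \<open>commutator_pow_eq_one_generate\<close> applies again.\<close>
  proof (rule commutator_pow_eq_one_swap)
    show "commutator G b a [^] n = \<one>"
      by (rule commutator_pow_eq_one_generate[OF X(1)])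
        (use that X * in \<open>auto intro: commutator_pow_eq_one_swap\<close>)
  qed (use that in auto)
  let ?C = "{commutator G a b |a b. a \<in> carrier G \<and> b \<in> carrier G}"
  \<comment> \<open>Centrality is carried through the induction, since the power of a product splits
    only for commuting factors.\<close>
  have "z \<in> carrier G \<and> (\<forall>c\<in>carrier G. z \<otimes> c = c \<otimes> z) \<and> z [^] n = \<one>"
    using z unfolding commutator_subgroup_commutator
  proof induction
    case (incl z)
    then show ?case by (auto simp: comm commutator_central)
  next
    case (inv z)
    \<comment> \<open>The inverse of [a, b] is the commutator of \<open>inv a\<close> and
      \<open>b\<close>, hence central too.\<close>
    then show ?case
      by (auto simp: comm commutator_central nat_pow_inv simp flip: commutator_inv_left)
  next
    case (eng y z)
    then have y: "y \<in> carrier G" "\<And>c. c \<in> carrier G \<Longrightarrow> y \<otimes> c = c \<otimes> y" "y [^] n = \<one>"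
      and z: "z \<in> carrier G" "\<And>c. c \<in> carrier G \<Longrightarrow> z \<otimes> c = c \<otimes> z" "z [^] n = \<one>"
      by blast+
    have "y \<otimes> z \<otimes> c = c \<otimes> (y \<otimes> z)" if c: "c \<in> carrier G" for c
    proof -
      have "y \<otimes> z \<otimes> c = y \<otimes> c \<otimes> z"
        using y(1) z(1) c by (simp add: m_assoc z(2)[OF c])
      also have "\<dots> = c \<otimes> (y \<otimes> z)"
        using y(1) z(1) c by (simp add: m_assoc y(2)[OF c])
      finally show ?thesis .
    qed
    moreover have "(y \<otimes> z) [^] n = \<one>"
      using pow_mult_distrib[OF y(2)[OF z(1)] y(1) z(1)] y(3) z(3) by simp
    ultimately show ?case
      using y(1) z(1) by blast
  qed auto
  then show ?thesis by simp
qed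

text \<open>Taking commutators with \<open>c\<close> is a homomorphism with commuting values, so
  \<open>s \<otimes> t\<close> and \<open>t \<otimes> s\<close> have the same image. Its k-th power
  cancels from the relation and leaves the single letters.\<close>

lemma commutator_eq_of_odd_relation:
  assumes "s \<in> carrier G" "t \<in> carrier G" "c \<in> carrier G"
    and "(s \<otimes> t) [^] (k::nat) \<otimes> s = (t \<otimes> s) [^] k \<otimes> t"
  shows "commutator G s c = commutator G t c"
proof -
  have "commutator G (s \<otimes> t) c = commutator G (t \<otimes> s) c"
    using assms by (simp add: commutator_mult_left commutator_commute)
  moreover have "commutator G (s \<otimes> t) c [^] k \<otimes> commutator G s c
      = commutator G (t \<otimes> s) c [^] k \<otimes> commutator G t c"
    using assms(1-3) arg_cong[OF assms(4), of "\<lambda>x. commutator G x c"]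
    by (simp add: commutator_mult_left[of "_ [^] _"] commutator_pow_left)
  ultimately show ?thesis
    using assms by simp
qed

text \<open>Since [s, t] is central, raising st = [s, t] ts to the power \<open>k\<close> gives
  (st)^k = [s, t]^k (ts)^k, and the relation cancels.\<close>

lemma commutator_pow_of_even_relation:
  assumes "s \<in> carrier G" "t \<in> carrier G" "(s \<otimes> t) [^] (k::nat) = (t \<otimes> s) [^] k"
  shows "commutator G s t [^] k = \<one>"
proof -
  have "(s \<otimes> t) [^] k = (commutator G s t \<otimes> (t \<otimes> s)) [^] k"
    using assms by (simp flip: mult_eq_commutator_mult)
  also have "\<dots> = commutator G s t [^] k \<otimes> (t \<otimes> s) [^] k"
    using assms by (intro pow_mult_distrib commutator_central) auto
  finally show ?thesis
    using assms by simp
qed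

end

section \<open>Orders and the quotient by the third lower central term\<close>

text \<open>The order of \<open>x\<close> divides every exponent in \<open>N\<close>, hence their
  gcd. For empty \<open>N\<close> the gcd is 0.\<close>

lemma (in group) pow_Gcd_eq_one:
  assumes "x \<in> carrier G" "\<And>n::nat. n \<in> N \<Longrightarrow> x [^] n = \<one>"
  shows "x [^] Gcd N = \<one>"
  using assms by (simp add: pow_eq_id Gcd_greatest)

text \<open>Triple commutators lie in the third term and become trivial in the quotient, which says
  that commutators there are central.\<close>

lemma (in group) class_two_group_Mod_lower_central:
  "class_two_group (G Mod lower_central G 3)"
proof -
  let ?N = "lower_central G 3"
  let ?Q = "G Mod ?N"
  interpret N: normal ?N G by (rule normal_lower_central)
  interpret Q: group ?Q by (rule N.factorgroup_is_group)
  interpret h: group_hom G ?Q "\<lambda>a. ?N #> a"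
    by unfold_locales (rule N.r_coset_hom_Mod)
  have L: "lower_central G 2 = commutator_subgroup G (carrier G) (carrier G)"
    "?N = commutator_subgroup G (carrier G) (lower_central G 2)"
    by (simp_all add: numeral_3_eq_3 numeral_2_eq_2)
  have two: "commutator G a b \<in> lower_central G 2" if "a \<in> carrier G" "b \<in> carrier G" for a b
    unfolding L commutator_subgroup_commutator using that by (blast intro: generate.incl)
  have three: "commutator G c z \<in> ?N" if "c \<in> carrier G" "z \<in> lower_central G 2" for c z
    unfolding L(2) commutator_subgroup_commutator using that by (blast intro: generate.incl)
  show ?thesis
  proof (unfold_locales)
    fix x y z
    assume xyz: "x \<in> carrier ?Q" "y \<in> carrier ?Q" "z \<in> carrier ?Q"
    then obtain a b c where abc: "a \<in> carrier G" "b \<in> carrier G" "c \<in> carrier G"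
      "x = ?N #> a" "y = ?N #> b" "z = ?N #> c"
      by (auto simp: carrier_FactGroup)
    have "?N #> commutator G c (commutator G a b) = \<one>\<^bsub>?Q\<^esub>"
      using three[OF abc(3) two[OF abc(1,2)]] abc(1-3)
      by (simp add: FactGroup_def coset_join2 N.subgroup_axioms)
    then have "commutator ?Q z (commutator ?Q x y) = \<one>\<^bsub>?Q\<^esub>"
      using abc by (simp flip: h.hom_commutator)
    \<comment> \<open>With trivial outer commutator, \<open>mult_eq_commutator_mult\<close> becomes
      the commutation of \<open>z\<close> with [x, y].\<close>
    then show "commutator ?Q x y \<otimes>\<^bsub>?Q\<^esub> z = z \<otimes>\<^bsub>?Q\<^esub> commutator ?Q x y"
      using xyz Q.mult_eq_commutator_mult[of z "commutator ?Q x y"]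
      by (metis Q.commutator_closed Q.l_one Q.m_closed)
  qed
qed


section \<open>Generators and relations of Artin groups\<close>

definition gen :: "'s set \<Rightarrow> ('s word \<times> 's word) set \<Rightarrow> 's \<Rightarrow> 's word set" where
  "gen S R s = word_cong S R `` {[(s, True)]}"

lemma carrier_presented_group:
  "carrier (presented_group S R) = (\<lambda>w. word_cong S R `` {w}) ` words S"
  by (auto simp: presented_group_def quotient_def)

lemma one_presented_group: "\<one>\<^bsub>presented_group S R\<^esub> = word_cong S R `` {[]}"
  by (simp add: presented_group_def)

lemma gen_closed [simp]: "s \<in> S \<Longrightarrow> gen S R s \<in> carrier (presented_group S R)"
  by (auto simp: gen_def carrier_presented_group)

lemma inv_gen:
  assumes "s \<in> S"
  shows "inv\<^bsub>presented_group S R\<^esub> (gen S R s) = word_cong S R `` {[(s, False)]}"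
proof -
  let ?P = "presented_group S R"
  interpret group ?P by (rule group_presented_group)
  have "([(s, False), (s, True)], []) \<in> word_cong S R"
    using word_cong.cancel[of "[]" S "[]" s False R] assms by simp
  then have "word_cong S R `` {[(s, False)]} \<otimes>\<^bsub>?P\<^esub> gen S R s = \<one>\<^bsub>?P\<^esub>"
    using assms equiv_class_eq[OF equiv_word_cong]
    by (fastforce simp: gen_def presented_group_mult one_presented_group)
  then show ?thesis
    using assms by (intro inv_equality) (auto simp: carrier_presented_group[of S R] gen_def)
qed

text \<open>A word is a product of letters, each the class of a generator or of its inverse. Torsion
  then needs testing only on generators.\<close>

lemma generate_gen:
  "generate (presented_group S R) (gen S R ` S) = carrier (presented_group S R)"
proof -
  let ?P = "presented_group S R"
  interpret group ?P by (rule group_presented_group)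
  have "word_cong S R `` {w} \<in> generate ?P (gen S R ` S)" if "w \<in> words S" for w
    using that
  proof (induction w)
    case Nil
    then show ?case
      by (simp add: generate.one flip: one_presented_group)
  next
    case (Cons x w)
    obtain s b where x: "x = (s, b)" and s: "s \<in> S" using Cons.prems by (cases x) auto
    have "word_cong S R `` {[x]} \<in> generate ?P (gen S R ` S)"
    proof (cases b)
      case True
      then show ?thesis using s x generate.incl[of "gen S R s" "gen S R ` S" ?P] by (simp add: gen_def)
    next
      case False
      then show ?thesis
        using s x generate.inv[of "gen S R s" "gen S R ` S" ?P] by (simp add: inv_gen)
    qed
    then have "word_cong S R `` {[x]} \<otimes>\<^bsub>?P\<^esub> word_cong S R `` {w} \<in> generate ?P (gen S R ` S)"
      using Cons by (intro generate.eng) auto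
    then show ?case
      using Cons.prems by (simp add: presented_group_mult)
  qed
  moreover have "generate ?P (gen S R ` S) \<subseteq> carrier ?P"
    by (intro generate_incl) auto
  ultimately show ?thesis
    by (auto simp: carrier_presented_group)
qed

lemma presented_group_relation:
  assumes "(p, q) \<in> R" "p \<in> words S" "q \<in> words S"
  shows "word_cong S R `` {p} = word_cong S R `` {q}"
  using equiv_class_eq[OF equiv_word_cong] word_cong.relation[of "[]" S "[]" p q R] assms by simp

section \<open>Alternating words as powers\<close>

lemma alternating_word_Suc:
  "alternating_word (Suc n) s t = alternating_word n s t @ [(if even n then s else t, True)]"
  by (simp add: alternating_word_def)

lemma alternating_word_words: "s \<in> S \<Longrightarrow> t \<in> S \<Longrightarrow> alternating_word n s t \<in> words S"
  by (induction n) (auto simp: alternating_word_Suc, simp add: alternating_word_def)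

lemma class_alternating_word_even:
  assumes "s \<in> S" "t \<in> S"
  shows "word_cong S R `` {alternating_word (2 * k) s t}
    = (gen S R s \<otimes>\<^bsub>presented_group S R\<^esub> gen S R t) [^]\<^bsub>presented_group S R\<^esub> k"
proof -
  let ?P = "presented_group S R"
  interpret group ?P by (rule group_presented_group)
  show ?thesis
  proof (induction k)
    case 0
    then show ?case by (simp add: alternating_word_def one_presented_group)
  next
    case (Suc k)
    have "word_cong S R `` {alternating_word (2 * Suc k) s t}
      = word_cong S R `` {alternating_word (2 * k) s t} \<otimes>\<^bsub>?P\<^esub> (gen S R s \<otimes>\<^bsub>?P\<^esub> gen S R t)"
      using assms by (simp add: alternating_word_Suc alternating_word_words gen_def
          presented_group_mult)
    then show ?case using Suc by simp
  qed
qed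

text \<open>The last letter has the even index 2k, counted from 0, so it is \<open>s\<close>; what
  precedes it is the even case.\<close>

lemma class_alternating_word_odd:
  assumes "s \<in> S" "t \<in> S"
  shows "word_cong S R `` {alternating_word (Suc (2 * k)) s t}
    = (gen S R s \<otimes>\<^bsub>presented_group S R\<^esub> gen S R t) [^]\<^bsub>presented_group S R\<^esub> k
        \<otimes>\<^bsub>presented_group S R\<^esub> gen S R s"
  using presented_group_mult[of "alternating_word (2 * k) s t" S "[(s, True)]" R] assms
  by (simp add: alternating_word_Suc alternating_word_words class_alternating_word_even
      flip: gen_def)

lemma artin_relation:
  assumes "s \<in> S" "t \<in> S" "M s t = enat m"
  shows "word_cong S (artin_relations S M) `` {alternating_word m s t}
    = word_cong S (artin_relations S M) `` {alternating_word m t s}"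
  by (rule presented_group_relation)
    (use assms in \<open>auto simp: artin_relations_def alternating_word_words\<close>)


section \<open>Class-two quotients of Artin groups\<close>

text \<open>The target \<open>H\<close> is kept abstract so that images of generators are handled
  without cosets; the quotient by the third lower central term is substituted at the end.\<close>

locale artin_class_two =
  H: class_two_group H + h: group_hom "artin_group S M" H h
  for S :: "'s set" and M and H (structure) and h +
  assumes coxeter: "coxeter_matrix S M"
begin

definition img where
  "img s = h (gen S (artin_relations S M) s)"

lemma img_closed [simp]: "s \<in> S \<Longrightarrow> img s \<in> carrier H"
  by (simp add: img_def artin_group_def)

lemma h_pow_mult_gen:
  assumes "s \<in> S" "t \<in> S"
  shows "h ((gen S (artin_relations S M) s \<otimes>\<^bsub>artin_group S M\<^esub> gen S (artin_relations S M) t)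
    [^]\<^bsub>artin_group S M\<^esub> (k::nat)) = (img s \<otimes> img t) [^] k"
proof -
  have "gen S (artin_relations S M) u \<in> carrier (artin_group S M)" if "u \<in> S" for u
    using that by (simp add: artin_group_def)
  with assms show ?thesis
    by (simp add: img_def h.hom_nat_pow)
qed

lemma img_even_relation:
  assumes "s \<in> S" "t \<in> S" "M s t = enat (2 * k)"
  shows "(img s \<otimes> img t) [^] k = (img t \<otimes> img s) [^] k"
proof -
  let ?g = "gen S (artin_relations S M)"
  let ?A = "artin_group S M"
  have "(?g s \<otimes>\<^bsub>?A\<^esub> ?g t) [^]\<^bsub>?A\<^esub> k = (?g t \<otimes>\<^bsub>?A\<^esub> ?g s) [^]\<^bsub>?A\<^esub> k"
    using artin_relation[of s S t M "2 * k"] assms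
    by (simp add: artin_group_def class_alternating_word_even)
  from arg_cong[OF this, of h] show ?thesis
    using assms by (simp add: h_pow_mult_gen)
qed

lemma img_odd_relation:
  assumes "s \<in> S" "t \<in> S" "M s t = enat (Suc (2 * k))"
  shows "(img s \<otimes> img t) [^] k \<otimes> img s = (img t \<otimes> img s) [^] k \<otimes> img t"
proof -
  let ?g = "gen S (artin_relations S M)"
  let ?A = "artin_group S M"
  have g: "?g u \<in> carrier ?A" if "u \<in> S" for u
    using that by (simp add: artin_group_def)
  have "(?g s \<otimes>\<^bsub>?A\<^esub> ?g t) [^]\<^bsub>?A\<^esub> k \<otimes>\<^bsub>?A\<^esub> ?g s = (?g t \<otimes>\<^bsub>?A\<^esub> ?g s) [^]\<^bsub>?A\<^esub> k \<otimes>\<^bsub>?A\<^esub> ?g t"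
    using artin_relation[of s S t M "Suc (2 * k)"] assms
    by (simp add: artin_group_def class_alternating_word_odd)
  from arg_cong[OF this, of h] show ?thesis
    using assms g by (simp add: h_pow_mult_gen) (simp add: img_def)
qed

section \<open>Commutators of generators and odd components\<close>

lemma commutator_img_odd_edge:
  assumes "(s, t) \<in> odd_edges S M" "c \<in> carrier H"
  shows "commutator H (img s) c = commutator H (img t) c"
proof -
  from assms obtain m where st: "s \<in> S" "t \<in> S" "M s t = enat m" "odd m"
    by (auto simp: odd_edges_def)
  from \<open>odd m\<close> obtain k where "m = Suc (2 * k)"
    by (auto elim: oddE)
  with st assms show ?thesis
    by (intro H.commutator_eq_of_odd_relation[of _ _ _ k] img_odd_relation) auto
qed

lemma commutator_img_connected:
  assumes "(s, t) \<in> (odd_edges S M)\<^sup>*" "c \<in> carrier H"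
  shows "commutator H (img s) c = commutator H (img t) c"
  using assms by (induction rule: rtrancl_induct) (auto dest: commutator_img_odd_edge)

text \<open>First \<open>s\<close> is moved to \<open>s'\<close> in the left argument, then
  \<open>t\<close> to \<open>t'\<close> after swapping the arguments.\<close>

lemma commutator_img_connected2:
  assumes "(s, s') \<in> (odd_edges S M)\<^sup>*" "(t, t') \<in> (odd_edges S M)\<^sup>*"
    and "s \<in> S" "s' \<in> S" "t \<in> S" "t' \<in> S"
  shows "commutator H (img s) (img t) = commutator H (img s') (img t')"
  using assms commutator_img_connected[of s s' "img t"] commutator_img_connected[of t t' "img s'"]
    H.commutator_swap[of "img s'" "img t"] H.commutator_swap[of "img s'" "img t'"]
  by simp

text \<open>Symmetry is inherited from the Coxeter matrix. The restriction to \<open>S\<close> is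
  there because \<open>rtrancl\<close> is reflexive on the whole type.\<close>

lemma equiv_odd_connected: "equiv S (Restr ((odd_edges S M)\<^sup>*) S)"
proof (rule equivI)
  have "sym (odd_edges S M)"
    using coxeter by (auto simp: sym_def odd_edges_def coxeter_matrix_def)
  then show "sym (Restr ((odd_edges S M)\<^sup>*) S)"
    using sym_rtrancl[of "odd_edges S M"] by (auto simp: sym_def)
  show "trans (Restr ((odd_edges S M)\<^sup>*) S)"
    by (auto simp: trans_def)
qed (auto simp: refl_on_def)

text \<open>Connectedness replaces [s, t] by [t, t]. This matches the diagonal value 1 of
  \<open>component_gcd\<close>.\<close>

lemma commutator_img_same_component:
  assumes "x \<in> odd_components S M" "s \<in> x" "t \<in> x"
  shows "commutator H (img s) (img t) = \<one>"
proof -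
  have "(s, t) \<in> Restr ((odd_edges S M)\<^sup>*) S"
    using assms equiv_odd_connected unfolding odd_components_def by (meson quotient_eq_iff)
  then show ?thesis
    using commutator_img_connected[of s t "img t"] by simp
qed

text \<open>All coefficients between two components thus bound the order of one and the same
  element.\<close>

lemma commutator_img_components:
  assumes "x \<in> odd_components S M" "y \<in> odd_components S M"
    and "s \<in> x" "s' \<in> x" "t \<in> y" "t' \<in> y"
  shows "commutator H (img s) (img t) = commutator H (img s') (img t')"
proof -
  have "(s, s') \<in> Restr ((odd_edges S M)\<^sup>*) S" "(t, t') \<in> Restr ((odd_edges S M)\<^sup>*) S"
    using assms equiv_odd_connected unfolding odd_components_def by (meson quotient_eq_iff)+
  then show ?thesis
    using commutator_img_connected2 by simp
qed

lemma odd_component_subset: "x \<in> odd_components S M \<Longrightarrow> x \<subseteq> S"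
  unfolding odd_components_def using equiv_odd_connected in_quotient_imp_subset by blast

section \<open>Torsion exponents\<close>

lemma commutator_img_pow_component_gcd:
  assumes "x \<in> odd_components S M" "y \<in> odd_components S M" "s \<in> x" "t \<in> y"
  shows "commutator H (img s) (img t) [^] component_gcd M x y = \<one>"
proof (cases "x = y")
  case True
  then show ?thesis
    using assms by (simp add: commutator_img_same_component)
next
  case False
  have S: "s \<in> S" "t \<in> S"
    using assms odd_component_subset by auto
  have "commutator H (img s) (img t) [^] (m div 2) = \<one>"
    if "s' \<in> x" "t' \<in> y" "M s' t' = enat m" for s' t' m
  proof -
    have S': "s' \<in> S" "t' \<in> S"
      using assms that odd_component_subset by auto
    \<comment> \<open>An odd coefficient would be an edge joining \<open>x\<close> to
      \<open>y\<close>. Evenness makes \<open>m div 2\<close> the exponent k of an even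
      relation.\<close>
    have "even m"
    proof (rule ccontr)
      assume "odd m"
      then have "(s', t') \<in> Restr ((odd_edges S M)\<^sup>*) S"
        using S' that by (auto simp: odd_edges_def)
      then have "x = y"
        using assms that equiv_odd_connected
        unfolding odd_components_def
        by (meson quotient_eqI)
      with False show False by simp
    qed
    then have "commutator H (img s') (img t') [^] (m div 2) = \<one>"
      using S' that by (intro H.commutator_pow_of_even_relation img_even_relation) auto
    then show ?thesis
      using commutator_img_components[of x y s s' t t'] assms that by simp
  qed
  then show ?thesis
    using False S by (auto simp: component_gcd_def intro!: H.pow_Gcd_eq_one)
qed

lemma commutator_img_pow_component_lcm:
  assumes "s \<in> S" "t \<in> S"
  shows "commutator H (img s) (img t) [^] component_lcm S M = \<one>"
proof -
  let ?E = "Restr ((odd_edges S M)\<^sup>*) S"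
  let ?x = "?E `` {s}" and ?y = "?E `` {t}"
  have xy: "?x \<in> odd_components S M" "?y \<in> odd_components S M"
    using assms by (auto simp: odd_components_def intro: quotientI)
  have "s \<in> ?x" "t \<in> ?y"
    using assms by auto
  with xy have "commutator H (img s) (img t) [^] component_gcd M ?x ?y = \<one>"
    by (rule commutator_img_pow_component_gcd)
  \<comment> \<open>This covers an unbounded family as well: the lcm is then 0, which everything
    divides.\<close>
  moreover have "component_gcd M ?x ?y dvd component_lcm S M"
    unfolding component_lcm_def using xy by (intro dvd_Lcm) blast
  ultimately show ?thesis
    using assms H.pow_eq_id[of "commutator H (img s) (img t)"]
    by (auto intro: dvd_trans)
qed

text \<open>Surjectivity makes the elements \<open>img s\<close> generate \<open>H\<close> and sends
  the second lower central term into the commutator subgroup of \<open>H\<close>, so torsion on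
  generators suffices.\<close>

lemma lower_central_two_torsion:
  assumes surj: "h ` carrier (artin_group S M) = carrier H"
    and z: "z \<in> lower_central (artin_group S M) 2"
  shows "h z [^] component_lcm S M = \<one>"
proof (rule H.commutator_subgroup_torsion)
  let ?g = "gen S (artin_relations S M)"
  have "h ` generate (artin_group S M) (?g ` S) = generate H (h ` ?g ` S)"
    by (rule h.generate_img[symmetric]) (auto simp: artin_group_def)
  then show "generate H (img ` S) = carrier H"
    using surj by (simp add: artin_group_def generate_gen image_image img_def)
  show "h z \<in> commutator_subgroup H (carrier H) (carrier H)"
    using z surj h.hom_commutator_subgroup[of "carrier (artin_group S M)" "carrier (artin_group S M)"]
    by (auto simp: numeral_2_eq_2)
qed (auto simp: commutator_img_pow_component_lcm)

end

theorem proposition2p13: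
  fixes S :: "'s set" and M :: "'s \<Rightarrow> 's \<Rightarrow> enat"
  assumes "coxeter_matrix S M"
    and "\<forall>s\<in>S. \<forall>t\<in>S. M s t \<noteq> \<infinity>"
  defines "A \<equiv> artin_group S M"
  defines "Q \<equiv> (A\<lparr>carrier := lower_central A 2\<rparr>) Mod (lower_central A 3)"
  shows "\<forall>x \<in> carrier Q. x [^]\<^bsub>Q\<^esub> component_lcm S M = \<one>\<^bsub>Q\<^esub>"
proof
  let ?N = "lower_central A 3" and ?L = "lower_central A 2" and ?d = "component_lcm S M"
  interpret A: group A
    unfolding A_def artin_group_def by (rule group_presented_group)
  interpret N: normal ?N A by (rule A.normal_lower_central)
  interpret h: group_hom A "A Mod ?N" "\<lambda>a. ?N #>\<^bsub>A\<^esub> a"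
    by (intro group_hom.intro group_hom_axioms.intro A.is_group N.factorgroup_is_group
        N.r_coset_hom_Mod)
  have hom: "group_hom (artin_group S M) (A Mod ?N) (\<lambda>a. ?N #>\<^bsub>A\<^esub> a)"
    using h.group_hom_axioms by (simp add: A_def)
  interpret artin_class_two S M "A Mod ?N" "\<lambda>a. ?N #>\<^bsub>A\<^esub> a"
    by (intro artin_class_two.intro artin_class_two_axioms.intro
        A.class_two_group_Mod_lower_central hom assms(1))
  fix x assume "x \<in> carrier Q"
  \<comment> \<open>Restricting the carrier leaves the coset formula unchanged, so elements of
    \<open>Q\<close> are cosets in \<open>A Mod ?N\<close> of elements of \<open>?L\<close>.\<close>
  then obtain z where z: "z \<in> ?L" "x = ?N #>\<^bsub>A\<^esub> z"
    by (auto simp: Q_def FactGroup_def RCOSETS_def r_coset_def)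
  \<comment> \<open>Both quotients multiply by the same set product and have the unit
    \<open>?N\<close>, so powers agree.\<close>
  have pow: "x [^]\<^bsub>Q\<^esub> (n::nat) = x [^]\<^bsub>A Mod ?N\<^esub> n" for n
    by (induction n) (simp_all add: Q_def FactGroup_def nat_pow_def set_mult_def)
  have "x [^]\<^bsub>A Mod ?N\<^esub> ?d = \<one>\<^bsub>A Mod ?N\<^esub>"
    unfolding z(2) using z(1)
    by (intro lower_central_two_torsion) (auto simp: A_def carrier_FactGroup)
  then show "x [^]\<^bsub>Q\<^esub> ?d = \<one>\<^bsub>Q\<^esub>"
    unfolding pow by (simp add: Q_def FactGroup_def)
qed

end
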